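(* Let $T$ be a tournament with $|V(T)|\le 3$ and let $ET$ be any extended tournament of $T$. Then $\chi'_{\mathrm{wo}}(ET)\le 2$.
   Context: A tournament is an orientation of a complete graph. Given a tournament $T$ with vertices $v_1,\dots,v_n$ and integers $s_1,\dots,s_n\ge 1$, the extended tournament $ET$ has vertex set $I_1\cup\dots\cup I_n$ (disjoint sets, $|I_i|=s_i$, each $I_i$ independent), and for $x\in I_i$, $y\in I_j$ ($i\ne j$) there is an arc $xy$ iff $v_iv_j\in A(T)$. For a vertex $v$ of a digraph $D$, the semi-cuts of $v$ are $\partial^+(v)$ (arcs leaving $v$) and $\partial^-(v)$ (arcs entering $v$). A map $\varphi:A(D)\to[k]=\{1,\dots,k\}$ satisfies condition (WO) at $v$ if there is a color $i\in[k]$ such that every nonempty semi-cut of $v$ contains an odd number of arcs of color $i$ (vacuous if both semi-cuts are empty). A weak-odd $k$-edge coloring is such a map satisfying (WO) at every vertex, and the weak-odd chromatic index $\chi'_{\mathrm{wo}}(D)$ is the least $k\ge0$ for which one exists. *)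

theory Defs
  imports
    "Graph_Theory.Pair_Digraph"
    "HOL-Library.Extended_Nat"
    "HOL-Library.Disjoint_Sets"
begin

locale tournament = pair_digraph T for T :: "'a pair_pre_digraph" +
  assumes one_direction:
    "\<And>u v. u \<in> pverts T \<Longrightarrow> v \<in> pverts T \<Longrightarrow> u \<noteq> v \<Longrightarrow>
      (u, v) \<in> parcs T \<longleftrightarrow> (v, u) \<notin> parcs T"

text \<open>
  The vertices of \<^term>\<open>T\<close> index the classes \<^term>\<open>I v\<close> and their sizes
  \<^term>\<open>s v\<close>. Independence of the classes is not listed separately: \<^term>\<open>T\<close> has no
  loops and the classes are disjoint, so no arc of \<^term>\<open>E\<close> joins two vertices of one class.
\<close>

definition extended_tournament ::
  "'a pair_pre_digraph \<Rightarrow> ('a \<Rightarrow> nat) \<Rightarrow> 'b pair_pre_digraph \<Rightarrow> bool" where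
  "extended_tournament T s E \<longleftrightarrow>
    tournament T \<and> (\<forall>v\<in>pverts T. s v \<ge> 1) \<and>
    (\<exists>I :: 'a \<Rightarrow> 'b set.
      (\<forall>v\<in>pverts T. finite (I v) \<and> card (I v) = s v) \<and>
      disjoint_family_on I (pverts T) \<and>
      pverts E = (\<Union>v\<in>pverts T. I v) \<and>
      parcs E = (\<Union>(u, v)\<in>parcs T. I u \<times> I v))"

definition semi_cuts :: "('a, 'b) pre_digraph \<Rightarrow> 'a \<Rightarrow> 'b set set" where
  "semi_cuts D v = {out_arcs D v, in_arcs D v}"

text \<open>
  The first disjunct makes the condition hold at isolated vertices even for
  \<^term>\<open>k = 0\<close>, when there is no color to choose.
\<close>

definition weak_odd_at :: "('a, 'b) pre_digraph \<Rightarrow> nat \<Rightarrow> ('b \<Rightarrow> nat) \<Rightarrow> 'a \<Rightarrow> bool" where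
  "weak_odd_at D k \<phi> v \<longleftrightarrow>
    (\<forall>C\<in>semi_cuts D v. C = {}) \<or>
    (\<exists>i\<in>{1..k}. \<forall>C\<in>semi_cuts D v. C \<noteq> {} \<longrightarrow> odd (card {e \<in> C. \<phi> e = i}))"

definition weak_odd_edge_coloring :: "('a, 'b) pre_digraph \<Rightarrow> nat \<Rightarrow> ('b \<Rightarrow> nat) \<Rightarrow> bool" where
  "weak_odd_edge_coloring D k \<phi> \<longleftrightarrow>
    \<phi> \<in> arcs D \<rightarrow> {1..k} \<and> (\<forall>v\<in>verts D. weak_odd_at D k \<phi> v)"

text \<open>
  The value is \<^term>\<open>\<infinity> :: enat\<close> if no weak-odd coloring exists, so a finite upper bound
  entails existence.
\<close>

definition weak_odd_chromatic_index :: "('a, 'b) pre_digraph \<Rightarrow> enat" where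
  "weak_odd_chromatic_index D = Inf (enat ` {k. \<exists>\<phi>. weak_odd_edge_coloring D k \<phi>})"

end

theory Submission
  imports Defs
begin

text \<open>
  Call a vertex set \<open>S\<close> odd if every nonempty out- or in-neighbourhood meets \<open>S\<close> in an odd
  number of vertices. Given such an \<open>S\<close>, color an arc 1 if exactly one of its ends lies in \<open>S\<close>,
  and 2 otherwise: color 1 is then odd at the vertices outside \<open>S\<close>, and color 2 at those in \<open>S\<close>.
  Picking one representative from each class lifts an odd set of \<open>T\<close> to one of the
  extended tournament. A cyclic triangle has all its vertices as an odd set; a transitive
  tournament on two or three vertices has its source and its sink.
\<close>

definition odd_set :: "'a pair_pre_digraph \<Rightarrow> 'a set \<Rightarrow> bool" where
  "odd_set D S \<longleftrightarrow> (\<forall>v\<in>pverts D.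
    ({w. (v, w) \<in> parcs D} \<noteq> {} \<longrightarrow> odd (card {w\<in>S. (v, w) \<in> parcs D})) \<and>
    ({w. (w, v) \<in> parcs D} \<noteq> {} \<longrightarrow> odd (card {w\<in>S. (w, v) \<in> parcs D})))"

lemma weak_odd_edge_coloring_odd_set:
  assumes "odd_set D S"
  shows "weak_odd_edge_coloring (with_proj D) 2
    (\<lambda>(u, v). if (u \<in> S) \<noteq> (v \<in> S) then 1 else 2)" (is "weak_odd_edge_coloring _ _ ?\<phi>")
  unfolding weak_odd_edge_coloring_def
proof (intro conjI ballI)
  show "?\<phi> \<in> arcs (with_proj D) \<rightarrow> {1..2}" by auto
next
  fix v assume "v \<in> verts (with_proj D)"
  then have v: "v \<in> pverts D" by simp
  \<comment> \<open>With this choice an arc between \<open>v\<close> and \<open>w\<close>, in either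
    direction, has color \<open>i\<close> exactly when \<open>w \<in> S\<close>. Counting color
    \<open>i\<close> in a semi-cut of \<open>v\<close> thus amounts to counting neighbours in
    \<open>S\<close>.\<close>
  define i :: nat where "i = (if v \<in> S then 2 else 1)"
  have "{e \<in> out_arcs (with_proj D) v. ?\<phi> e = i} = Pair v ` {w\<in>S. (v, w) \<in> parcs D}"
    by (auto simp: i_def out_arcs_def split: if_splits)
  then have out: "card {e \<in> out_arcs (with_proj D) v. ?\<phi> e = i} = card {w\<in>S. (v, w) \<in> parcs D}"
    by (simp add: card_image inj_on_def)
  have "{e \<in> in_arcs (with_proj D) v. ?\<phi> e = i} = (\<lambda>w. (w, v)) ` {w\<in>S. (w, v) \<in> parcs D}"
    by (auto simp: i_def in_arcs_def split: if_splits)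
  then have "in": "card {e \<in> in_arcs (with_proj D) v. ?\<phi> e = i} = card {w\<in>S. (w, v) \<in> parcs D}"
    by (simp add: card_image inj_on_def)
  have "i \<in> {1..2}" by (simp add: i_def)
  moreover have "\<forall>C\<in>semi_cuts (with_proj D) v. C \<noteq> {} \<longrightarrow> odd (card {e \<in> C. ?\<phi> e = i})"
    using assms v out "in" by (auto simp: odd_set_def semi_cuts_def out_arcs_def in_arcs_def)
  ultimately show "weak_odd_at (with_proj D) 2 ?\<phi> v"
    unfolding weak_odd_at_def by blast
qed

lemma weak_odd_chromatic_index_le:
  assumes "weak_odd_edge_coloring D k \<phi>"
  shows "weak_odd_chromatic_index D \<le> enat k"
  unfolding weak_odd_chromatic_index_def using assms by (auto intro: Inf_lower)

text \<open>A vertex \<open>x\<close> of the class \<open>I v\<close> sees the representative of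
  \<open>I w\<close> exactly as \<open>v\<close> sees \<open>w\<close> in \<open>T\<close>. With one
  representative per class, the counts at \<open>x\<close> equal those at \<open>v\<close>, whatever
  the class sizes.\<close>

lemma odd_set_extended_tournament:
  fixes T :: "'a pair_pre_digraph" and E :: "'b pair_pre_digraph"
  assumes E: "extended_tournament T s E" and U: "U \<subseteq> pverts T" "odd_set T U"
  obtains S where "odd_set E S"
proof -
  have T: "tournament T" and s: "\<forall>v\<in>pverts T. s v \<ge> 1"
    using E unfolding extended_tournament_def by auto
  obtain I :: "'a \<Rightarrow> 'b set" where I: "\<forall>v\<in>pverts T. finite (I v) \<and> card (I v) = s v"
    and disj: "disjoint_family_on I (pverts T)"
    and vE: "pverts E = (\<Union>v\<in>pverts T. I v)"
    and aE: "parcs E = (\<Union>(u, v)\<in>parcs T. I u \<times> I v)"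
    using E unfolding extended_tournament_def by blast
  interpret tournament T by (fact T)
  have arcs: "u \<in> pverts T" "v \<in> pverts T" if "(u, v) \<in> parcs T" for u v
    using that in_arcsD1 in_arcsD2 by auto
  have same: "u = v" if "u \<in> pverts T" "v \<in> pverts T" "x \<in> I u" "x \<in> I v" for u v x
    using disj that unfolding disjoint_family_on_def by blast
  \<comment> \<open>The bound \<open>s v \<ge> 1\<close> makes every class nonempty, so a
    representative can be chosen.\<close>
  have "\<exists>x. x \<in> I v" if "v \<in> pverts T" for v
    using I s that by (metis card.empty ex_in_conv not_one_le_zero)
  then obtain r where r: "\<And>v. v \<in> pverts T \<Longrightarrow> r v \<in> I v" by metis
  have inj: "inj_on r U"
    using r same U(1) by (metis inj_onI subsetD)
  \<comment> \<open>By disjointness \<open>x\<close> and \<open>y\<close> determine their classes,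
    so an arc \<open>(x, y)\<close> can only stem from the arc \<open>(u, v)\<close> of
    \<open>T\<close>.\<close>
  have arcE: "(x, y) \<in> parcs E \<longleftrightarrow> (u, v) \<in> parcs T"
    if "u \<in> pverts T" "v \<in> pverts T" "x \<in> I u" "y \<in> I v" for u v x y
    using that same arcs unfolding aE by blast
  have "odd_set E (r ` U)"
    unfolding odd_set_def
  proof (intro ballI conjI impI)
    fix x assume "x \<in> pverts E"
    then obtain v where v: "v \<in> pverts T" "x \<in> I v" using vE by auto
    have rep: "(x, r w) \<in> parcs E \<longleftrightarrow> (v, w) \<in> parcs T"
      "(r w, x) \<in> parcs E \<longleftrightarrow> (w, v) \<in> parcs T" if "w \<in> U" for w
      using arcE[OF v(1) _ v(2) r] arcE[OF _ v(1) r v(2)] that U(1) by blast+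
    {
      assume "{y. (x, y) \<in> parcs E} \<noteq> {}"
      \<comment> \<open>Every arc leaving \<open>x\<close> lies over an arc leaving
        \<open>v\<close>, so the oddness of \<open>U\<close> at \<open>v\<close> applies.\<close>
      then have "{w. (v, w) \<in> parcs T} \<noteq> {}"
        using v same arcs unfolding aE by blast
      then have "odd (card {w\<in>U. (v, w) \<in> parcs T})"
        using U(2) v(1) unfolding odd_set_def by blast
      moreover have "{y \<in> r ` U. (x, y) \<in> parcs E} = r ` {w\<in>U. (v, w) \<in> parcs T}"
        using rep by auto
      ultimately show "odd (card {y \<in> r ` U. (x, y) \<in> parcs E})"
        using inj by (simp add: card_image inj_on_def)
    next
      assume "{y. (y, x) \<in> parcs E} \<noteq> {}"
      then have "{w. (w, v) \<in> parcs T} \<noteq> {}"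
        using v same arcs unfolding aE by blast
      then have "odd (card {w\<in>U. (w, v) \<in> parcs T})"
        using U(2) v(1) unfolding odd_set_def by blast
      moreover have "{y \<in> r ` U. (y, x) \<in> parcs E} = r ` {w\<in>U. (w, v) \<in> parcs T}"
        using rep by auto
      ultimately show "odd (card {y \<in> r ` U. (y, x) \<in> parcs E})"
        using inj by (simp add: card_image inj_on_def)
    }
  qed
  then show thesis by (rule that)
qed

lemma odd_set_single_arc:
  assumes "parcs D = {(a, b)}" "a \<noteq> b"
  shows "odd_set D {a, b}"
proof -
  have "{w \<in> {a, b}. w = b} = {b}" "{w \<in> {a, b}. w = a} = {a}" by auto
  then show ?thesis using assms by (auto simp: odd_set_def)
qed

text \<open>The sink \<open>c\<close> is an out-neighbour of both other vertices, while the source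
  \<open>a\<close> is an out-neighbour of none. So every nonempty out-neighbourhood meets the set in
  \<open>{c}\<close> and, dually, every nonempty in-neighbourhood meets it in
  \<open>{a}\<close>.\<close>

lemma odd_set_transitive_triangle:
  assumes "parcs D = {(a, b), (b, c), (a, c)}" "a \<noteq> b" "b \<noteq> c" "a \<noteq> c"
  shows "odd_set D {a, c}"
proof -
  have "{w \<in> {a, c}. (a, w) \<in> parcs D} = {c}" "{w \<in> {a, c}. (b, w) \<in> parcs D} = {c}"
    "{w \<in> {a, c}. (w, b) \<in> parcs D} = {a}" "{w \<in> {a, c}. (w, c) \<in> parcs D} = {a}"
    using assms by auto
  then have "odd (card {w \<in> {a, c}. (v, w) \<in> parcs D})" if "(v, u) \<in> parcs D" for u v
    using that assms(1) by auto
  moreover have "odd (card {w \<in> {a, c}. (w, v) \<in> parcs D})" if "(u, v) \<in> parcs D" for u v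
    using that assms(1) \<open>{w \<in> {a, c}. (w, b) \<in> parcs D} = {a}\<close>
      \<open>{w \<in> {a, c}. (w, c) \<in> parcs D} = {a}\<close> by auto
  ultimately show ?thesis unfolding odd_set_def by blast
qed

text \<open>Each of the three vertices has exactly one out-neighbour and one in-neighbour, so all
  the counts are 1.\<close>

lemma odd_set_cyclic_triangle:
  assumes "parcs D = {(a, b), (b, c), (c, a)}" "a \<noteq> b" "b \<noteq> c" "a \<noteq> c"
  shows "odd_set D {a, b, c}"
proof -
  have out: "{w \<in> {a, b, c}. (a, w) \<in> parcs D} = {b}" "{w \<in> {a, b, c}. (b, w) \<in> parcs D} = {c}"
    "{w \<in> {a, b, c}. (c, w) \<in> parcs D} = {a}"
    using assms by auto
  have "in": "{w \<in> {a, b, c}. (w, a) \<in> parcs D} = {c}" "{w \<in> {a, b, c}. (w, b) \<in> parcs D} = {a}"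
    "{w \<in> {a, b, c}. (w, c) \<in> parcs D} = {b}"
    using assms by auto
  have "odd (card {w \<in> {a, b, c}. (v, w) \<in> parcs D})" if "(v, u) \<in> parcs D" for u v
  proof -
    have "v = a \<or> v = b \<or> v = c" using that assms(1) by auto
    then show ?thesis using out by (elim disjE) (simp_all only:, simp_all)
  qed
  moreover have "odd (card {w \<in> {a, b, c}. (w, v) \<in> parcs D})" if "(u, v) \<in> parcs D" for u v
  proof -
    have "v = a \<or> v = b \<or> v = c" using that assms(1) by auto
    then show ?thesis using "in" by (elim disjE) (simp_all only:, simp_all)
  qed
  ultimately show ?thesis unfolding odd_set_def by blast
qed

text \<open>With at most one vertex there are no arcs and the empty set works. Two vertices span a
  single arc, and on three vertices the orientation is either transitive or cyclic.\<close>

lemma tournament_odd_set_exists: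
  assumes "tournament T" "card (pverts T) \<le> 3"
  obtains U where "U \<subseteq> pverts T" "odd_set T U"
proof -
  interpret tournament T by (fact assms(1))
  have arcs: "u \<in> pverts T \<and> v \<in> pverts T \<and> u \<noteq> v" if "(u, v) \<in> parcs T" for u v
    using that in_arcsD1 in_arcsD2 no_loops by fastforce
  have "card (pverts T) = 0 \<or> card (pverts T) = 1 \<or> card (pverts T) = 2 \<or> card (pverts T) = 3"
    using assms(2) by linarith
  then consider "card (pverts T) = 0" | a where "pverts T = {a}"
    | a b where "pverts T = {a, b}" "a \<noteq> b"
    | a b c where "pverts T = {a, b, c}" "a \<noteq> b" "b \<noteq> c" "a \<noteq> c"
    by (metis card_1_singletonE card_2_iff card_3_iff)
  then show thesis
  proof cases
    case 1
    \<comment> \<open>Since \<open>T\<close> is finite, cardinality 0 means that there are no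
      vertices.\<close>
    then have "odd_set T {}" by (simp add: odd_set_def)
    then show thesis using that by blast
  next
    case (2 a)
    then have "parcs T = {}" using arcs by auto
    then have "odd_set T {}" by (simp add: odd_set_def)
    then show thesis using that by blast
  next
    case (3 a b)
    have "parcs T = {(a, b)} \<or> parcs T = {(b, a)}"
    proof -
      have "parcs T \<subseteq> {(a, b), (b, a)}"
      proof (rule subrelI)
        fix u v assume "(u, v) \<in> parcs T"
        then show "(u, v) \<in> {(a, b), (b, a)}" using arcs[of u v] 3(1) by auto
      qed
      moreover have "(a, b) \<in> parcs T \<longleftrightarrow> (b, a) \<notin> parcs T" 
        by (rule one_direction) (use 3 in auto)
      ultimately show ?thesis by blast
    qed
    then have "odd_set T {a, b}"
      using odd_set_single_arc[of T a b] odd_set_single_arc[of T b a] 3(2)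
      by (auto simp: insert_commute)
    then show thesis using that 3(1) by blast
  next
    case (4 a b c)
    have sub: "parcs T \<subseteq> {(a, b), (b, a), (b, c), (c, b), (a, c), (c, a)}"
    proof (rule subrelI)
      fix u v assume "(u, v) \<in> parcs T"
      then show "(u, v) \<in> {(a, b), (b, a), (b, c), (c, b), (a, c), (c, a)}"
        using arcs[of u v] 4(1) by auto
    qed
    have dir: "(b, a) \<in> parcs T \<longleftrightarrow> (a, b) \<notin> parcs T" "(c, b) \<in> parcs T \<longleftrightarrow> (b, c) \<notin> parcs T"
      "(c, a) \<in> parcs T \<longleftrightarrow> (a, c) \<notin> parcs T"
      by (rule one_direction; use 4 in auto)+
    \<comment> \<open>\<open>?P x y z\<close> is the transitive orientation with source
      \<open>x\<close> and sink \<open>z\<close>; \<open>?Q x y z\<close> is the directed cycle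
      through \<open>x\<close>, \<open>y\<close>, \<open>z\<close>.\<close>
    let ?P = "\<lambda>x y z. parcs T = {(x, y), (y, z), (x, z)}"
    let ?Q = "\<lambda>x y z. parcs T = {(x, y), (y, z), (z, x)}"
    have eq: "parcs T = {if (a, b) \<in> parcs T then (a, b) else (b, a),
        if (b, c) \<in> parcs T then (b, c) else (c, b), if (a, c) \<in> parcs T then (a, c) else (c, a)}"
      (is "_ = {?e, ?f, ?g}")
    proof
      show "parcs T \<subseteq> {?e, ?f, ?g}"
      proof
        fix e assume e: "e \<in> parcs T"
        with sub have "e \<in> {(a, b), (b, a), (b, c), (c, b), (a, c), (c, a)}" by (rule subsetD)
        then show "e \<in> {?e, ?f, ?g}" using e dir by (elim insertE) simp_all
      qed
      show "{?e, ?f, ?g} \<subseteq> parcs T" using dir by simp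
    qed
    \<comment> \<open>The eight orientations of a labelled triangle: six linear orders and two
      directed cycles.\<close>
    have "?P a b c \<or> ?P a c b \<or> ?P b a c \<or> ?P b c a \<or> ?P c a b \<or> ?P c b a \<or> ?Q a b c \<or> ?Q a c b"
    proof -
      \<comment> \<open>The membership tests in \<open>eq\<close> mention \<open>parcs T\<close>
        itself. Replacing them by free truth values leaves a plain split into eight cases.\<close>
      obtain p q r where "parcs T = {if p then (a, b) else (b, a),
        if q then (b, c) else (c, b), if r then (a, c) else (c, a)}"
        using eq by blast
      then show ?thesis by (cases p; cases q; cases r; simp add: insert_commute)
    qed
    moreover have "\<exists>U\<subseteq>{a, b, c}. odd_set T U"
      if "?P x y z" "x \<noteq> y" "y \<noteq> z" "x \<noteq> z" "{x, z} \<subseteq> {a, b, c}" for x y z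
      using odd_set_transitive_triangle[OF that(1-4)] that(5) by blast
    moreover have "\<exists>U\<subseteq>{a, b, c}. odd_set T U"
      if "?Q x y z" "x \<noteq> y" "y \<noteq> z" "x \<noteq> z" "{x, y, z} \<subseteq> {a, b, c}" for x y z
      using odd_set_cyclic_triangle[OF that(1-4)] that(5) by blast
    ultimately have "\<exists>U\<subseteq>{a, b, c}. odd_set T U"
      using 4(2-4) by (elim disjE) blast+
    then show thesis using that 4(1) by blast
  qed
qed

theorem theorem4p3:
  fixes T :: "'a pair_pre_digraph"
    and s :: "'a \<Rightarrow> nat"
    and ET :: "'b pair_pre_digraph"
  assumes "tournament T"
    and "card (pverts T) \<le> 3"
    and "extended_tournament T s ET"
  shows "weak_odd_chromatic_index (with_proj ET) \<le> 2"
proof -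
  obtain U where "U \<subseteq> pverts T" "odd_set T U"
    using tournament_odd_set_exists[OF assms(1,2)] .
  then obtain S where "odd_set ET S"
    using odd_set_extended_tournament[OF assms(3)] by blast
  then show ?thesis
    using weak_odd_chromatic_index_le[OF weak_odd_edge_coloring_odd_set]
    by (fastforce simp: numeral_eq_enat)
qed

end
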